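(* Let $R,E\in\mathbb{C}^{M\times M}$ be Hermitian, $\widehat R=R+E$, and let $\mathcal{B}\subseteq\mathbb{C}^{M\times M}$ be a finite-dimensional linear subspace. If a nonzero $A^\ast\in\mathcal{B}$ satisfies $[R,A^\ast]=0$ (so $\lambda_{\min}(R)=0$), then $$\lambda_{\min}(\widehat R)\le\frac{\|[E,A^\ast]\|_F^2}{\|A^\ast\|_F^2}\le 4\|E\|_2^2 .$$
   Context: $[X,Y]=XY-YX$; $\|\cdot\|_F$ is the Frobenius norm and $\|\cdot\|_2$ the operator norm. For Hermitian $X$, and a basis $B_1,\dots,B_d$ of $\mathcal{B}$, $\lambda_{\min}(X)$ is the smallest generalized eigenvalue of $\mathbf{M}(X)\mathbf{c}=\lambda\mathbf{G}\mathbf{c}$ with $\mathbf{M}(X)_{ij}=\operatorname{Tr}(B_i^H[X,[X,B_j]])$, $\mathbf{G}_{ij}=\operatorname{Tr}(B_i^HB_j)$; equivalently $\lambda_{\min}(X)=\min_{0\ne A\in\mathcal{B}}\|[X,A]\|_F^2/\|A\|_F^2$. *)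

theory Defs
  imports "HOL-Analysis.Analysis"
begin

definition cmat_scale :: "complex \<Rightarrow> complex^'n^'m \<Rightarrow> complex^'n^'m" where
  "cmat_scale c A = (\<chi> i j. c * A $ i $ j)"

text \<open>The library \<open>subspace\<close>, \<open>span\<close> and \<open>independent\<close> on \<open>complex^'n^'m\<close> refer to
  real scalars; the complex vector space structure is the following one.\<close>

global_interpretation cmat: vector_space "cmat_scale :: complex \<Rightarrow> complex^'n^'m \<Rightarrow> complex^'n^'m"
  by standard (simp_all add: cmat_scale_def vec_eq_iff algebra_simps)

definition cmat_basis :: "('d \<Rightarrow> complex^'n^'m) \<Rightarrow> (complex^'n^'m) set \<Rightarrow> bool" where
  "cmat_basis B V \<longleftrightarrow> inj B \<and> cmat.independent (range B) \<and> cmat.span (range B) = V"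

definition ctranspose :: "complex^'n^'m \<Rightarrow> complex^'m^'n" where
  "ctranspose A = (\<chi> i j. cnj (A $ j $ i))"

definition hermitian :: "complex^'m^'m \<Rightarrow> bool" where
  "hermitian A \<longleftrightarrow> ctranspose A = A"

definition commutator :: "complex^'m^'m \<Rightarrow> complex^'m^'m \<Rightarrow> complex^'m^'m" where
  "commutator X Y = X ** Y - Y ** X"

definition frob_norm :: "complex^'n^'m \<Rightarrow> real" where
  "frob_norm A = sqrt (\<Sum>i\<in>UNIV. \<Sum>j\<in>UNIV. (cmod (A $ i $ j))\<^sup>2)"

lemma frob_norm_eq_norm: "frob_norm A = norm A"
  by (simp add: frob_norm_def norm_vec_def L2_set_def sum_nonneg)

definition op_norm :: "complex^'n^'m \<Rightarrow> real" where
  "op_norm A = onorm ((*v) A)"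

definition comm_matrix :: "('d \<Rightarrow> complex^'m^'m) \<Rightarrow> complex^'m^'m \<Rightarrow> complex^'d^'d" where
  "comm_matrix B X =
     (\<chi> i j. trace (ctranspose (B i) ** commutator X (commutator X (B j))))"

definition gram_matrix :: "('d \<Rightarrow> complex^'m^'m) \<Rightarrow> complex^'d^'d" where
  "gram_matrix B = (\<chi> i j. trace (ctranspose (B i) ** B j))"

definition gen_eigenvalue :: "complex^'d^'d \<Rightarrow> complex^'d^'d \<Rightarrow> complex \<Rightarrow> bool" where
  "gen_eigenvalue K G l \<longleftrightarrow> (\<exists>c. c \<noteq> 0 \<and> K *v c = l *s (G *v c))"

text \<open>For Hermitian \<open>X\<close> and linearly independent \<open>B\<close> the pencil is Hermitian with positive
  definite \<open>gram_matrix B\<close>, so all its generalized eigenvalues are real and the restriction to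
  real \<open>l\<close> omits none. The index type \<open>'d\<close> is nonempty, so a smallest one exists; without these
  hypotheses on \<open>X\<close> and \<open>B\<close> the value of \<open>LEAST\<close> need not be meaningful.\<close>

definition lambda_min :: "('d::finite \<Rightarrow> complex^'m^'m) \<Rightarrow> complex^'m^'m \<Rightarrow> real" where
  "lambda_min B X =
     (LEAST l :: real. gen_eigenvalue (comm_matrix B X) (gram_matrix B) (complex_of_real l))"

end

theory Submission
  imports Defs
begin

text \<open>The generalized eigenvalue equation for the coefficient vector of \<open>Y \<in> V\<close> says that
  \<open>[X,[X,Y]] - l Y\<close> is orthogonal to \<open>V\<close>. Testing with \<open>Y\<close> itself and using that \<open>[X,_]\<close> is
  self-adjoint shows that every real generalized eigenvalue is a Rayleigh quotient
  \<open>\<parallel>[X,Y]\<parallel>\<^sup>2 / \<parallel>Y\<parallel>\<^sup>2\<close>. Conversely a minimizer of this quotient on the unit sphere of \<open>V\<close>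
  satisfies the equation by vanishing of the first variation. Hence \<open>lambda_min\<close> is the minimum
  of the Rayleigh quotient, and evaluating the quotient at \<open>A\<close>, where \<open>[R+E,A] = [E,A]\<close>,
  gives the bounds.\<close>

section \<open>The complex trace form and the real inner product\<close>

lemma trace_ctranspose_mult:
  "trace (ctranspose Z ** W) = (\<Sum>i\<in>UNIV. \<Sum>j\<in>UNIV. cnj (Z $ i $ j) * W $ i $ j)"
  unfolding trace_def ctranspose_def matrix_matrix_mult_def
  by (simp, subst sum.swap, rule refl)

text \<open>The pencil is built from the complex trace form, while compactness and first variation
  use the real inner product; this identity links the two.\<close>

lemma inner_eq_Re_trace:
  fixes Z W :: "complex^'n^'m"
  shows "Z \<bullet> W = Re (trace (ctranspose Z ** W))"
  by (simp add: trace_ctranspose_mult inner_vec_def inner_complex_def)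

lemma trace_ctranspose_cmat_scale:
  "trace (ctranspose (cmat_scale c Z) ** W) = cnj c * trace (ctranspose Z ** W)"
  by (simp add: trace_ctranspose_mult cmat_scale_def sum_distrib_left mult.assoc)

lemma trace_ctranspose_cmat_scale_right:
  "trace (ctranspose Z ** cmat_scale c W) = trace (ctranspose Z ** W) * c"
  by (simp add: trace_ctranspose_mult cmat_scale_def sum_distrib_left mult_ac)

lemma trace_ctranspose_add:
  "trace (ctranspose (Y + Z) ** W) = trace (ctranspose Y ** W) + trace (ctranspose Z ** W)"
  by (simp add: trace_ctranspose_mult sum.distrib distrib_right)

lemma cmat_scale_of_real: "cmat_scale (of_real r) A = r *\<^sub>R A"
  by (simp add: cmat_scale_def vec_eq_iff) (simp add: scaleR_conv_of_real)

text \<open>Real scalars act as complex ones, so topological facts about real subspaces, such as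
  closedness, apply to \<open>V\<close>.\<close>

lemma cmat_subspace_imp_subspace:
  assumes "cmat.subspace V"
  shows "subspace V"
  using cmat.subspace_0[OF assms] cmat.subspace_add[OF assms]
    cmat.subspace_scale[OF assms, of _ "of_real r" for r]
  by (auto simp: subspace_def cmat_scale_of_real)

text \<open>The form is conjugate linear in \<open>Z\<close>, so for fixed \<open>W\<close> its
  zeros form a complex subspace.\<close>

lemma trace_ctranspose_eq_0_span:
  assumes "\<And>i. trace (ctranspose (B i) ** W) = 0" and "Z \<in> cmat.span (range B)"
  shows "trace (ctranspose Z ** W) = 0"
  using assms(2)
proof (induction rule: cmat.span_induct_alt)
  case base
  show ?case by (simp add: trace_ctranspose_mult)
next
  case (step c x y)
  then show ?case
    using assms(1) by (auto simp: trace_ctranspose_add trace_ctranspose_cmat_scale)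
qed

text \<open>The imaginary part of the complex form at \<open>Z\<close> is its real part at \<open>\<i> Z\<close>.\<close>

lemma trace_ctranspose_eq_0_if_inner:
  fixes V :: "(complex^'n^'m) set"
  assumes V: "cmat.subspace V" and orth: "\<And>Z. Z \<in> V \<Longrightarrow> Z \<bullet> W = 0" and Z: "Z \<in> V"
  shows "trace (ctranspose Z ** W) = 0"
proof -
  have "cmat_scale \<i> Z \<bullet> W = 0"
    using orth cmat.subspace_scale[OF V Z] by blast
  then have "Im (trace (ctranspose Z ** W)) = 0"
    by (simp add: inner_eq_Re_trace trace_ctranspose_cmat_scale)
  moreover have "Re (trace (ctranspose Z ** W)) = 0"
    using orth[OF Z] by (simp add: inner_eq_Re_trace)
  ultimately show ?thesis by (simp add: complex_eq_iff)
qed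

section \<open>Adjoints and self-adjointness of the commutator map\<close>

lemma ctranspose_mult: "ctranspose (X ** Y) = ctranspose Y ** ctranspose X"
  by (simp add: ctranspose_def matrix_matrix_mult_def vec_eq_iff mult.commute)

lemma ctranspose_diff: "ctranspose (X - Y) = ctranspose X - ctranspose Y"
  by (simp add: ctranspose_def vec_eq_iff)

lemma ctranspose_ctranspose [simp]: "ctranspose (ctranspose X) = X"
  by (simp add: ctranspose_def vec_eq_iff)

lemma norm_ctranspose: "norm (ctranspose X) = norm X"
proof -
  have "frob_norm (ctranspose X) = frob_norm X"
    unfolding frob_norm_def ctranspose_def by (simp, subst sum.swap, rule refl)
  then show ?thesis by (simp add: frob_norm_eq_norm)
qed

lemma matrix_mult_sub_left: "(X - Y) ** Z = X ** Z - Y ** (Z :: complex^'n^'m)"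
  by (simp add: matrix_matrix_mult_def vec_eq_iff left_diff_distrib sum_subtractf)

lemma matrix_mult_sub_right: "Z ** (X - Y) = Z ** X - Z ** (Y :: complex^'n^'m)"
  by (simp add: matrix_matrix_mult_def vec_eq_iff right_diff_distrib sum_subtractf)

text \<open>Taking the adjoint of \<open>commutator X Y\<close> leaves \<open>X\<close> in front of
  \<open>ctranspose Y\<close> in one term; cyclicity of the trace carries it behind
  \<open>Z\<close>.\<close>

lemma inner_commutator:
  assumes "hermitian X"
  shows "commutator X Y \<bullet> Z = Y \<bullet> commutator X Z"
proof -
  have X: "ctranspose X = X" using assms by (simp add: hermitian_def)
  have "trace (ctranspose Y ** X ** Z - X ** ctranspose Y ** Z)
      = trace (ctranspose Y ** X ** Z) - trace (X ** (ctranspose Y ** Z))"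
    by (simp add: trace_sub matrix_mul_assoc)
  also have "trace (X ** (ctranspose Y ** Z)) = trace (ctranspose Y ** Z ** X)"
    by (rule trace_mul_sym)
  finally show ?thesis
    by (simp add: inner_eq_Re_trace commutator_def ctranspose_diff ctranspose_mult X
        matrix_mult_sub_left matrix_mult_sub_right trace_sub matrix_mul_assoc)
qed

section \<open>Coordinates with respect to a basis\<close>

definition lincomb :: "('d::finite \<Rightarrow> complex^'n^'m) \<Rightarrow> complex^'d \<Rightarrow> complex^'n^'m" where
  "lincomb B c = (\<Sum>j\<in>UNIV. cmat_scale (c $ j) (B j))"

lemma lincomb_nth: "lincomb B c $ i $ k = (\<Sum>j\<in>UNIV. c $ j * B j $ i $ k)"
  by (simp add: lincomb_def cmat_scale_def sum_component)

lemma lincomb_eq_0_iff: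
  assumes "cmat_basis B V"
  shows "lincomb B c = 0 \<longleftrightarrow> c = 0"
proof
  assume 0: "lincomb B c = 0"
  have B: "inj B" "cmat.independent (range B)"
    using assms by (auto simp: cmat_basis_def)
  \<comment> \<open>Independence is stated for sets, so injectivity of \<open>B\<close> is used to
    reindex the sum by basis vectors.\<close>
  have "(\<Sum>v\<in>range B. cmat_scale (c $ inv B v) v) = 0"
    using 0 B(1) by (simp add: sum.reindex lincomb_def)
  then have "c $ inv B (B j) = 0" for j
    using cmat.independentD[OF B(2), of "range B" "\<lambda>v. c $ inv B v" "B j"] by simp
  then show "c = 0" using B(1) by (simp add: vec_eq_iff)
qed (simp add: lincomb_def)

lemma range_lincomb:
  assumes "cmat_basis B V"
  shows "range (lincomb B) = V"
proof -
  have B: "inj B" "cmat.span (range B) = V"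
    using assms by (auto simp: cmat_basis_def)
  have "lincomb B c \<in> V" for c
    unfolding lincomb_def B(2)[symmetric]
    by (intro cmat.span_sum cmat.span_scale cmat.span_base) simp
  moreover have "v \<in> range (lincomb B)" if "v \<in> V" for v
  proof -
    have "v \<in> range (\<lambda>u. \<Sum>b\<in>range B. cmat_scale (u b) b)"
      using that B(2) cmat.span_finite[of "range B"] by simp
    then obtain u where "v = (\<Sum>b\<in>range B. cmat_scale (u b) b)"
      by (rule rangeE)
    then have "v = lincomb B (\<chi> j. u (B j))"
      using B(1) by (simp add: sum.reindex lincomb_def)
    then show ?thesis by blast
  qed
  ultimately show ?thesis by auto
qed

section \<open>The matrix pencil in terms of the trace form\<close>

lemma gram_matrix_mult: "(gram_matrix B *v c) $ i = trace (ctranspose (B i) ** lincomb B c)"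
proof -
  have "trace (ctranspose (B i) ** lincomb B c)
      = (\<Sum>p\<in>UNIV. \<Sum>q\<in>UNIV. \<Sum>j\<in>UNIV. cnj (B i $ p $ q) * B j $ p $ q * c $ j)"
    by (simp add: trace_ctranspose_mult lincomb_nth sum_distrib_left mult_ac)
  also have "\<dots> = (\<Sum>p\<in>UNIV. \<Sum>j\<in>UNIV. \<Sum>q\<in>UNIV. cnj (B i $ p $ q) * B j $ p $ q * c $ j)"
    by (intro sum.cong refl sum.swap)
  also have "\<dots> = (\<Sum>j\<in>UNIV. \<Sum>p\<in>UNIV. \<Sum>q\<in>UNIV. cnj (B i $ p $ q) * B j $ p $ q * c $ j)"
    by (rule sum.swap)
  finally show ?thesis
    by (simp add: gram_matrix_def matrix_vector_mult_def trace_ctranspose_mult sum_distrib_right)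
qed

lemma trace_ctranspose_sum_right:
  "trace (ctranspose Z ** (\<Sum>j\<in>S. cmat_scale (c j) (W j)))
    = (\<Sum>j\<in>S. trace (ctranspose Z ** W j) * c j)"
proof -
  have "trace (ctranspose Z ** (X + Y)) =
      trace (ctranspose Z ** X) + trace (ctranspose Z ** Y)" for X Y
    by (simp add: trace_ctranspose_mult sum.distrib distrib_left)
  moreover have "trace (0 :: complex^'k^'k) = 0"
    by (simp add: trace_def)
  ultimately show ?thesis
    by (induction S rule: infinite_finite_induct) (simp_all add: trace_ctranspose_cmat_scale_right)
qed

lemma commutator_cmat_scale: "commutator X (cmat_scale c Y) = cmat_scale c (commutator X Y)"
  by (simp add: commutator_def cmat_scale_def matrix_matrix_mult_def vec_eq_iff
      right_diff_distrib sum_distrib_left mult_ac)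

lemma linear_commutator: "linear (commutator X)"
proof (rule linearI)
  show "commutator X (Y + Z) = commutator X Y + commutator X Z" for Y Z
    by (simp add: commutator_def matrix_matrix_mult_def vec_eq_iff sum.distrib
        distrib_left distrib_right)
  show "commutator X (r *\<^sub>R Y) = r *\<^sub>R commutator X Y" for r Y
    by (simp add: cmat_scale_of_real[symmetric] commutator_cmat_scale)
qed

lemma commutator_lincomb: "commutator X (lincomb B c) = lincomb (\<lambda>j. commutator X (B j)) c"
  by (simp add: lincomb_def linear_sum[OF linear_commutator] commutator_cmat_scale)

lemma comm_matrix_mult:
  "(comm_matrix B X *v c) $ i
    = trace (ctranspose (B i) ** commutator X (commutator X (lincomb B c)))"
  unfolding commutator_lincomb
  by (simp add: comm_matrix_def matrix_vector_mult_def lincomb_def trace_ctranspose_sum_right)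

text \<open>Coordinate \<open>i\<close> of the eigenvalue equation pairs \<open>B i\<close> with the
  residual. Vanishing on the basis extends to the complex span; conversely real orthogonality to
  \<open>V\<close> suffices, because \<open>V\<close> is closed under multiplication by
  \<open>\<i>\<close>.\<close>

lemma gen_eigenvalue_iff:
  assumes B: "cmat_basis B V"
  shows "gen_eigenvalue (comm_matrix B X) (gram_matrix B) (complex_of_real l) \<longleftrightarrow>
    (\<exists>Y\<in>V. Y \<noteq> 0 \<and> (\<forall>Z\<in>V. Z \<bullet> (commutator X (commutator X Y) - l *\<^sub>R Y) = 0))"
    (is "?L \<longleftrightarrow> ?R")
proof -
  have span: "cmat.span (range B) = V" using B by (simp add: cmat_basis_def)
  have V: "cmat.subspace V" using cmat.subspace_span[of "range B"] by (simp add: span)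
  have BV: "B i \<in> V" for i
    using cmat.span_base[of "B i" "range B"] by (simp add: span)
  let ?W = "\<lambda>Y. commutator X (commutator X Y) - l *\<^sub>R Y"
  have orth: "(\<forall>i. trace (ctranspose (B i) ** W) = 0) \<longleftrightarrow> (\<forall>Z\<in>V. Z \<bullet> W = 0)" for W
  proof
    assume "\<forall>i. trace (ctranspose (B i) ** W) = 0"
    then have "trace (ctranspose Z ** W) = 0" if "Z \<in> V" for Z
      using trace_ctranspose_eq_0_span[of B W Z] that by (simp add: span)
    then show "\<forall>Z\<in>V. Z \<bullet> W = 0"
      by (simp add: inner_eq_Re_trace)
  next
    assume "\<forall>Z\<in>V. Z \<bullet> W = 0"
    then show "\<forall>i. trace (ctranspose (B i) ** W) = 0"
      using trace_ctranspose_eq_0_if_inner[OF V] BV by blast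
  qed
  have "trace (ctranspose (B i) ** ?W (lincomb B c))
      = (comm_matrix B X *v c) $ i - (complex_of_real l *s (gram_matrix B *v c)) $ i" for c i
    unfolding comm_matrix_mult vector_smult_component gram_matrix_mult
    by (simp add: matrix_mult_sub_right trace_sub cmat_scale_of_real[symmetric]
        trace_ctranspose_cmat_scale_right)
  then have "?L \<longleftrightarrow>
      (\<exists>c. c \<noteq> 0 \<and> (\<forall>i. trace (ctranspose (B i) ** ?W (lincomb B c)) = 0))"
    by (simp add: gen_eigenvalue_def vec_eq_iff)
  also have "\<dots> \<longleftrightarrow> (\<exists>c. lincomb B c \<noteq> 0 \<and> (\<forall>Z\<in>V. Z \<bullet> ?W (lincomb B c) = 0))"
    by (simp add: orth lincomb_eq_0_iff[OF B])
  also have "\<dots> \<longleftrightarrow> ?R"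
    unfolding range_lincomb[OF B, symmetric] by simp
  finally show ?thesis .
qed

section \<open>The smallest eigenvalue as minimum of the Rayleigh quotient\<close>

lemma linear_coeff_eq_0:
  fixes a b :: real
  assumes "\<And>t. 0 \<le> 2 * t * a + t\<^sup>2 * b"
  shows "a = 0"
proof (rule ccontr)
  assume "a \<noteq> 0"
  \<comment> \<open>Near zero the linear term beats the quadratic one. At
    \<open>t = - (s * a)\<close> the form equals \<open>(s * a\<^sup>2) * (s * b - 2)\<close>, and
    this \<open>s\<close> keeps \<open>s * b\<close> below 2 whatever the sign of
    \<open>b\<close>.\<close>
  define s where "s = 1 / (\<bar>b\<bar> + 1)"
  have s: "0 < s" "s * b < 2"
    by (auto simp: s_def field_simps abs_if)
  have "0 \<le> 2 * (- (s * a)) * a + (- (s * a))\<^sup>2 * b" by (rule assms)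
  also have "\<dots> = (s * a\<^sup>2) * (s * b - 2)"
    by (simp add: power2_eq_square algebra_simps)
  also have "\<dots> < 0"
    using s \<open>a \<noteq> 0\<close> by (intro mult_pos_neg) auto
  finally show False by simp
qed

lemma ex_gen_eigenvalue_minimizer:
  fixes B :: "'d::finite \<Rightarrow> complex^'m^'m"
  assumes X: "hermitian X" and B: "cmat_basis B V" and A: "A \<in> V" "A \<noteq> 0"
  obtains l where "gen_eigenvalue (comm_matrix B X) (gram_matrix B) (complex_of_real l)"
    and "\<And>Z. Z \<in> V \<Longrightarrow> l * (norm Z)\<^sup>2 \<le> (norm (commutator X Z))\<^sup>2"
proof -
  have V: "subspace V"
    using B by (intro cmat_subspace_imp_subspace) (auto simp: cmat_basis_def)
  let ?S = "sphere 0 1 \<inter> V"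
  have "compact ?S"
    by (intro compact_Int_closed compact_sphere closed_subspace V)
  \<comment> \<open>Normalizing \<open>A\<close> shows that the unit sphere of \<open>V\<close> is
    nonempty, so the minimum is attained.\<close>
  moreover have "(1 / norm A) *\<^sub>R A \<in> ?S"
    using A V by (simp add: subspace_scale)
  moreover have "continuous_on ?S (\<lambda>Y. norm (commutator X Y))"
    by (intro continuous_on_norm linear_continuous_on linear_conv_bounded_linear[THEN iffD1]
        linear_commutator)
  ultimately obtain Y where Y: "Y \<in> ?S"
    and min: "\<And>Z. Z \<in> ?S \<Longrightarrow> norm (commutator X Y) \<le> norm (commutator X Z)"
    using continuous_attains_inf[of ?S "\<lambda>Y. norm (commutator X Y)"] by blast
  define l where "l = (norm (commutator X Y))\<^sup>2"
  have le: "l * (norm Z)\<^sup>2 \<le> (norm (commutator X Z))\<^sup>2" if Z: "Z \<in> V" for Z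
  proof (cases "Z = 0")
    case False
    \<comment> \<open>Homogeneity of the commutator carries the bound from the unit sphere to all of
      \<open>V\<close>.\<close>
    have "norm (commutator X Y) \<le> norm (commutator X ((1 / norm Z) *\<^sub>R Z))"
      using Z False V by (intro min) (simp add: subspace_scale)
    also have "\<dots> = norm (commutator X Z) / norm Z"
      by (simp add: linear_cmul[OF linear_commutator])
    finally have "norm (commutator X Y) * norm Z \<le> norm (commutator X Z)"
      using False by (simp add: field_simps)
    then show ?thesis
      unfolding l_def power_mult_distrib[symmetric] by (intro power_mono) simp_all
  qed simp
  have "Z \<bullet> (commutator X (commutator X Y) - l *\<^sub>R Y) = 0" if Z: "Z \<in> V" for Z
  proof -
    let ?C = "commutator X"
    \<comment> \<open>This is the gap in \<open>le\<close> along the line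
      \<open>Y + t *\<^sub>R Z\<close>. Its constant term vanishes because
      \<open>norm Y = 1\<close>, so nonnegativity for all real \<open>t\<close> forces the linear
      coefficient to be zero.\<close>
    have "0 \<le> 2 * t * (?C Y \<bullet> ?C Z - l * (Y \<bullet> Z)) + t\<^sup>2 * ((norm (?C Z))\<^sup>2 - l * (norm Z)\<^sup>2)"
      for t
    proof -
      have "l * (norm (Y + t *\<^sub>R Z))\<^sup>2 \<le> (norm (?C Y + t *\<^sub>R ?C Z))\<^sup>2"
        using le[of "Y + t *\<^sub>R Z"] Y Z V
        by (simp add: subspace_add subspace_scale linear_add[OF linear_commutator]
            linear_cmul[OF linear_commutator])
      moreover have expand: "(norm (U + t *\<^sub>R W))\<^sup>2
          = (norm U)\<^sup>2 + 2 * t * (U \<bullet> W) + t\<^sup>2 * (norm W)\<^sup>2" for U W :: "complex^'m^'m"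
        unfolding power2_norm_eq_inner
        by (simp add: inner_add inner_commute power2_eq_square algebra_simps)
      moreover have "(norm (?C Y))\<^sup>2 = l * (norm Y)\<^sup>2"
        using Y by (simp add: l_def)
      ultimately show ?thesis
        by (simp add: algebra_simps)
    qed
    then have "?C Y \<bullet> ?C Z - l * (Y \<bullet> Z) = 0"
      by (rule linear_coeff_eq_0)
    \<comment> \<open>Self-adjointness turns \<open>?C Y \<bullet> ?C Z\<close> into
      \<open>Z \<bullet> ?C (?C Y)\<close>.\<close>
    then show ?thesis
      using inner_commutator[OF X, of Z "?C Y"]
      by (simp add: inner_diff_right inner_commute)
  qed
  then have "gen_eigenvalue (comm_matrix B X) (gram_matrix B) (complex_of_real l)"
    unfolding gen_eigenvalue_iff[OF B] using Y by (intro bexI[of _ Y]) auto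
  with le that show ?thesis by blast
qed

lemma gen_eigenvalue_rayleigh:
  assumes X: "hermitian X" and B: "cmat_basis B V"
    and "gen_eigenvalue (comm_matrix B X) (gram_matrix B) (complex_of_real l)"
  obtains Y where "Y \<in> V" "Y \<noteq> 0" "(norm (commutator X Y))\<^sup>2 = l * (norm Y)\<^sup>2"
proof -
  obtain Y where Y: "Y \<in> V" "Y \<noteq> 0"
    and "Y \<bullet> (commutator X (commutator X Y) - l *\<^sub>R Y) = 0"
    using assms(3) unfolding gen_eigenvalue_iff[OF B] by blast
  then have "(norm (commutator X Y))\<^sup>2 = l * (norm Y)\<^sup>2"
    by (simp add: power2_norm_eq_inner inner_diff_right inner_commutator[OF X])
  with Y that show ?thesis by blast
qed

text \<open>The minimum of the quotient is an eigenvalue and lies below every other real one, since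
  each of them is a value of the quotient; hence \<open>LEAST\<close> returns it.\<close>

lemma lambda_min_bounds:
  assumes X: "hermitian X" and B: "cmat_basis B V" and A: "A \<in> V" "A \<noteq> 0"
  shows "0 \<le> lambda_min B X"
    and "lambda_min B X \<le> (norm (commutator X A))\<^sup>2 / (norm A)\<^sup>2"
proof -
  obtain l where l: "gen_eigenvalue (comm_matrix B X) (gram_matrix B) (complex_of_real l)"
    and le: "\<And>Z. Z \<in> V \<Longrightarrow> l * (norm Z)\<^sup>2 \<le> (norm (commutator X Z))\<^sup>2"
    using ex_gen_eigenvalue_minimizer[OF assms] by blast
  have "l \<le> k"
    if k: "gen_eigenvalue (comm_matrix B X) (gram_matrix B) (complex_of_real k)" for k
  proof -
    obtain Y where "Y \<in> V" "Y \<noteq> 0" "(norm (commutator X Y))\<^sup>2 = k * (norm Y)\<^sup>2"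
      using gen_eigenvalue_rayleigh[OF X B k] by blast
    then show ?thesis using le[of Y] by simp
  qed
  with l have eq: "lambda_min B X = l"
    unfolding lambda_min_def by (intro Least_equality) auto
  \<comment> \<open>Being a quotient of squared norms, \<open>l\<close> itself cannot be
    negative.\<close>
  obtain Y where "Y \<noteq> 0" "(norm (commutator X Y))\<^sup>2 = l * (norm Y)\<^sup>2"
    using gen_eigenvalue_rayleigh[OF X B l] by blast
  then have "0 \<le> l * (norm Y)\<^sup>2" "0 < (norm Y)\<^sup>2"
    by (metis zero_le_power2, simp)
  then show "0 \<le> lambda_min B X"
    unfolding eq by (simp add: zero_le_mult_iff)
  show "lambda_min B X \<le> (norm (commutator X A))\<^sup>2 / (norm A)\<^sup>2"
    unfolding eq using le[OF A(1)] A(2) by (simp add: pos_le_divide_eq)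
qed

section \<open>Frobenius norm bounds for products and commutators\<close>

lemma norm_matrix_power2_columns:
  fixes A :: "complex^'n^'m"
  shows "(norm A)\<^sup>2 = (\<Sum>j\<in>UNIV. (norm (column j A))\<^sup>2)"
proof -
  have "(norm A)\<^sup>2 = (\<Sum>i\<in>UNIV. \<Sum>j\<in>UNIV. (cmod (A $ i $ j))\<^sup>2)"
    by (simp add: frob_norm_eq_norm[symmetric] frob_norm_def sum_nonneg)
  also have "\<dots> = (\<Sum>j\<in>UNIV. \<Sum>i\<in>UNIV. (cmod (A $ i $ j))\<^sup>2)"
    by (rule sum.swap)
  finally show ?thesis
    by (simp add: norm_vec_def L2_set_def sum_nonneg column_def)
qed

text \<open>Left multiplication acts on each column separately, so the operator norm bound is
  applied columnwise and the squares are summed.\<close>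

lemma norm_matrix_mult_le:
  fixes E :: "complex^'n^'m" and A :: "complex^'k^'n"
  shows "norm (E ** A) \<le> op_norm E * norm A"
proof (rule power2_le_imp_le)
  have col: "column j (E ** A) = E *v column j A" for j
    by (simp add: column_def matrix_matrix_mult_def matrix_vector_mult_def vec_eq_iff)
  have "norm (E *v v) \<le> op_norm E * norm v" for v
    unfolding op_norm_def by (intro onorm matrix_vector_mul_bounded_linear)
  then have "(norm (E *v v))\<^sup>2 \<le> (op_norm E)\<^sup>2 * (norm v)\<^sup>2" for v
    unfolding power_mult_distrib[symmetric] by (intro power_mono) auto
  then show "(norm (E ** A))\<^sup>2 \<le> (op_norm E * norm A)\<^sup>2"
    by (simp add: norm_matrix_power2_columns col power_mult_distrib sum_distrib_left sum_mono)
  show "0 \<le> op_norm E * norm A"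
    unfolding op_norm_def
    by (intro mult_nonneg_nonneg onorm_pos_le matrix_vector_mul_bounded_linear norm_ge_zero)
qed

lemma norm_commutator_le:
  assumes "hermitian E"
  shows "norm (commutator E A) \<le> 2 * op_norm E * norm A"
proof -
  \<comment> \<open>The adjoint preserves the Frobenius norm and fixes \<open>E\<close>, so it moves
    \<open>E\<close> to the left, where the product bound applies.\<close>
  have "norm (A ** E) = norm (E ** ctranspose A)"
    using assms by (metis ctranspose_mult hermitian_def norm_ctranspose)
  also have "\<dots> \<le> op_norm E * norm A"
    using norm_matrix_mult_le[of E "ctranspose A"] by (simp add: norm_ctranspose)
  finally show ?thesis
    unfolding commutator_def
    using norm_triangle_ineq4[of "E ** A" "A ** E"] norm_matrix_mult_le[of E A] by linarith
qed

theorem theorem9p4: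
  fixes R E A :: "complex^'m^'m"
    and V :: "(complex^'m^'m) set"
    and B :: "'d::finite \<Rightarrow> complex^'m^'m"
  assumes "hermitian R" and "hermitian E"
    and "cmat.subspace V" and "cmat_basis B V"
    and "A \<in> V" and "A \<noteq> 0" and "commutator R A = 0"
  shows "lambda_min B R = 0
    \<and> lambda_min B (R + E) \<le> (frob_norm (commutator E A))\<^sup>2 / (frob_norm A)\<^sup>2
    \<and> (frob_norm (commutator E A))\<^sup>2 / (frob_norm A)\<^sup>2 \<le> 4 * (op_norm E)\<^sup>2"
proof (intro conjI)
  \<comment> \<open>The quotient at \<open>A\<close> is zero, so the upper bound meets the lower
    bound 0.\<close>
  show "lambda_min B R = 0"
    using lambda_min_bounds[OF assms(1,4-6)] assms(7) by simp
  have "hermitian (R + E)"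
    using assms(1,2) by (simp add: hermitian_def ctranspose_def vec_eq_iff)
  \<comment> \<open>Since \<open>commutator R A = 0\<close>, only the perturbation contributes to
    the quotient at \<open>A\<close>.\<close>
  moreover have "commutator (R + E) A = commutator R A + commutator E A"
    by (simp add: commutator_def matrix_matrix_mult_def vec_eq_iff algebra_simps sum.distrib)
  ultimately show
    "lambda_min B (R + E) \<le> (frob_norm (commutator E A))\<^sup>2 / (frob_norm A)\<^sup>2"
    using lambda_min_bounds(2)[of "R + E", OF _ assms(4-6)] assms(7)
    by (simp add: frob_norm_eq_norm)
  have "(norm (commutator E A))\<^sup>2 \<le> (2 * op_norm E * norm A)\<^sup>2"
    by (intro power_mono norm_commutator_le assms(2)) simp
  then show "(frob_norm (commutator E A))\<^sup>2 / (frob_norm A)\<^sup>2 \<le> 4 * (op_norm E)\<^sup>2"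
    using assms(6) by (simp add: frob_norm_eq_norm pos_divide_le_eq power_mult_distrib)
qed

end
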